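(* Let $\mathcal S$ be the class of ordered simplicial complexes lying in both QE and QC. The Tutte polynomial $$T(\Psi,x,y)=\sum_{B\in\mathcal B(\Psi)}x^{|IA(B)|}y^{|EA(B)|},\qquad \Psi\in\mathcal S,$$ (sum over the set $\mathcal B(\Psi)$ of bases of $\Psi$) is a Tutte-Grothendieck invariant on $\mathcal S$, and it is universal in the following sense: if $f$ is a Tutte-Grothendieck invariant on $\mathcal S$, then for every $\Psi\in\mathcal S$, $$f(\Psi)=T\big(\Psi,f(\Psi_{\mathrm{coloop}}),f(\Psi_{\mathrm{loop}})\big).$$
   Context: An ordered simplicial complex is a pair $\Psi=(E,\Delta)$ with $E$ a finite totally ordered set and $\Delta\subseteq 2^E$ a simplicial complex (closed under taking subsets, $\emptyset\in\Delta$). Two such complexes are isomorphic if the ground sets have the same cardinality and the unique order-preserving bijection between them induces a bijection of the complexes. Elements of $\Delta$ are independent sets; inclusion-maximal ones are bases; inclusion-minimal subsets of $E$ not in $\Delta$ are circuits. $\Psi$ is pure if all bases have the same cardinality. A loop is an element of $E$ in no basis; a vertex is an element of $E$ that is not a loop; a coloop is an element lying in every basis. The lexicographic order on subsets is the dictionary order on increasingly sorted lists. For $A\subseteq E$, $\Psi|_A=(A,\{I\in\Delta:I\subseteq A\})$. $\Psi_{\mathrm{loop}}=(\{e\},\{\emptyset\})$ and $\Psi_{\mathrm{coloop}}=(\{e\},\{\emptyset,\{e\}\})$. QE: the class of $\Psi$ that are pure and such that for all bases $B_1,B_2$ and $b_1\in B_1\setminus B_2$ with $b_1>\max(B_2\setminus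 B_1)$, there is $b_2\in B_2\setminus B_1$ with $(B_1\setminus\{b_1\})\cup\{b_2\}\in\Delta$. QC: the class of $\Psi$ such that if $C_1\neq C_2$ are circuits and $c\in C_1\cap C_2$ satisfies $c<\max (C_1\triangle C_2)$, where $\triangle$ is symmetric difference, then there is a circuit $C_3\subseteq (C_1\cup C_2)\setminus\{c\}$. For a basis $B$: $b\in B$ is internally active if $B$ is the lexicographically smallest basis containing $B\setminus\{b\}$; $IA(B)$ is the set of internally active elements. An element $e\in E\setminus B$ is externally active if some circuit $C\subseteq B\cup\{e\}$ has smallest element $e$; $EA(B)$ is the set of externally active elements. Let $R$ be a ring. An invariant is a map $f$ assigning to each $\Psi\in\mathcal S$ an element $f(\Psi)\in R$, with $f(\Psi)=f(\Psi')$ whenever $\Psi$ and $\Psi'$ are isomorphic. A Tutte-Grothendieck invariant is an invariant satisfying the recurrence: $f(\Psi)=f(\Psi|_{\{e\}})\,f(\Psi|_{E\setminus\{e\}})$ if $e$ is a loop or a coloop; and $f(\Psi)=f(\Psi/e)+f(\Psi\setminus e)$ if $e$ is the largest non-coloop vertex of $\Psi$, where the two complexes on the right are the contraction $\Psi/e=(E\setminus\{e\},\{J\subseteq E\setminus\{e\}:J\cup\{e\}\in\Delta\})$ and the deletion $\Psi\setminus e=\Psi|_{E\setminus\{e\}}$ of $e$.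
   Formalization: At the empty complex (E empty) the universality formula is claimed only when f takes the value 1 there, since f = 0 is a Tutte-Grothendieck invariant while T of the empty complex is 1; the ring R is taken to be unital and nonzero. *)

theory Defs
  imports Main "HOL-Computational_Algebra.Polynomial"
begin

text \<open>
  A finite totally ordered set is represented as a finite subset of a linearly ordered type.
  All notions below depend only on the order restricted to the ground set.
\<close>

type_synonym 'a cplx = "'a set \<times> 'a set set"

abbreviation ground :: "'a cplx \<Rightarrow> 'a set" where
  "ground \<equiv> fst"

abbreviation indep :: "'a cplx \<Rightarrow> 'a set set" where
  "indep \<equiv> snd"

definition ordered_simplicial_complex :: "'a::linorder cplx \<Rightarrow> bool" where
  "ordered_simplicial_complex \<Psi> \<longleftrightarrow>
     finite (ground \<Psi>) \<and> indep \<Psi> \<subseteq> Pow (ground \<Psi>) \<and> {} \<in> indep \<Psi> \<and>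
     (\<forall>I\<in>indep \<Psi>. \<forall>J. J \<subseteq> I \<longrightarrow> J \<in> indep \<Psi>)"

definition isomorphic :: "'a::linorder cplx \<Rightarrow> 'a cplx \<Rightarrow> bool" where
  "isomorphic \<Psi> \<Psi>' \<longleftrightarrow>
     (\<exists>\<phi>. bij_betw \<phi> (ground \<Psi>) (ground \<Psi>') \<and> strict_mono_on (ground \<Psi>) \<phi> \<and>
          (\<lambda>I. \<phi> ` I) ` indep \<Psi> = indep \<Psi>')"

definition bases :: "'a cplx \<Rightarrow> 'a set set" where
  "bases \<Psi> = {B \<in> indep \<Psi>. \<forall>I\<in>indep \<Psi>. B \<subseteq> I \<longrightarrow> I = B}"

definition circuits :: "'a cplx \<Rightarrow> 'a set set" where
  "circuits \<Psi> = {C. C \<subseteq> ground \<Psi> \<and> C \<notin> indep \<Psi> \<and> (\<forall>D. D \<subset> C \<longrightarrow> D \<in> indep \<Psi>)}"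

definition pure :: "'a cplx \<Rightarrow> bool" where
  "pure \<Psi> \<longleftrightarrow> (\<forall>B1\<in>bases \<Psi>. \<forall>B2\<in>bases \<Psi>. card B1 = card B2)"

definition is_loop :: "'a cplx \<Rightarrow> 'a \<Rightarrow> bool" where
  "is_loop \<Psi> e \<longleftrightarrow> e \<in> ground \<Psi> \<and> (\<forall>B\<in>bases \<Psi>. e \<notin> B)"

definition is_vertex :: "'a cplx \<Rightarrow> 'a \<Rightarrow> bool" where
  "is_vertex \<Psi> e \<longleftrightarrow> e \<in> ground \<Psi> \<and> \<not> is_loop \<Psi> e"

definition is_coloop :: "'a cplx \<Rightarrow> 'a \<Rightarrow> bool" where
  "is_coloop \<Psi> e \<longleftrightarrow> e \<in> ground \<Psi> \<and> (\<forall>B\<in>bases \<Psi>. e \<in> B)"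

definition largest_noncoloop_vertex :: "'a::linorder cplx \<Rightarrow> 'a \<Rightarrow> bool" where
  "largest_noncoloop_vertex \<Psi> e \<longleftrightarrow>
     is_vertex \<Psi> e \<and> \<not> is_coloop \<Psi> e \<and>
     (\<forall>v. is_vertex \<Psi> v \<and> \<not> is_coloop \<Psi> v \<longrightarrow> v \<le> e)"

definition lex_le :: "'a::linorder set \<Rightarrow> 'a set \<Rightarrow> bool" where
  "lex_le A B \<longleftrightarrow> lexordp_eq (sorted_list_of_set A) (sorted_list_of_set B)"

definition restriction :: "'a cplx \<Rightarrow> 'a set \<Rightarrow> 'a cplx" where
  "restriction \<Psi> A = (A, {I \<in> indep \<Psi>. I \<subseteq> A})"

definition deletion :: "'a cplx \<Rightarrow> 'a \<Rightarrow> 'a cplx" where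
  "deletion \<Psi> e = restriction \<Psi> (ground \<Psi> - {e})"

definition contraction :: "'a cplx \<Rightarrow> 'a \<Rightarrow> 'a cplx" where
  "contraction \<Psi> e = (ground \<Psi> - {e}, {J. J \<subseteq> ground \<Psi> - {e} \<and> J \<union> {e} \<in> indep \<Psi>})"

definition loop_complex :: "'a \<Rightarrow> 'a cplx" where
  "loop_complex e = ({e}, {{}})"

definition coloop_complex :: "'a \<Rightarrow> 'a cplx" where
  "coloop_complex e = ({e}, {{}, {e}})"

text \<open>
  In the next two definitions \<open>Max\<close> is applied to nonempty sets only: bases are pairwise
  incomparable, and \<open>C1 \<noteq> C2\<close>.
\<close>

definition QE :: "'a::linorder cplx set" where
  "QE = {\<Psi>. ordered_simplicial_complex \<Psi> \<and> pure \<Psi> \<and>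
     (\<forall>B1\<in>bases \<Psi>. \<forall>B2\<in>bases \<Psi>. \<forall>b1\<in>B1 - B2. Max (B2 - B1) < b1 \<longrightarrow>
        (\<exists>b2\<in>B2 - B1. (B1 - {b1}) \<union> {b2} \<in> indep \<Psi>))}"

definition QC :: "'a::linorder cplx set" where
  "QC = {\<Psi>. ordered_simplicial_complex \<Psi> \<and>
     (\<forall>C1\<in>circuits \<Psi>. \<forall>C2\<in>circuits \<Psi>. \<forall>c\<in>C1 \<inter> C2.
        C1 \<noteq> C2 \<and> c < Max ((C1 - C2) \<union> (C2 - C1)) \<longrightarrow>
        (\<exists>C3\<in>circuits \<Psi>. C3 \<subseteq> (C1 \<union> C2) - {c}))}"

definition IA :: "'a::linorder cplx \<Rightarrow> 'a set \<Rightarrow> 'a set" where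
  "IA \<Psi> B = {b \<in> B. \<forall>B'\<in>bases \<Psi>. B - {b} \<subseteq> B' \<longrightarrow> lex_le B B'}"

definition EA :: "'a::linorder cplx \<Rightarrow> 'a set \<Rightarrow> 'a set" where
  "EA \<Psi> B = {e \<in> ground \<Psi> - B.
     \<exists>C\<in>circuits \<Psi>. C \<subseteq> B \<union> {e} \<and> e \<in> C \<and> (\<forall>c\<in>C. e \<le> c)}"

definition tutte :: "'a::linorder cplx \<Rightarrow> 'r::ring_1 \<Rightarrow> 'r \<Rightarrow> 'r" where
  "tutte \<Psi> x y = (\<Sum>B\<in>bases \<Psi>. x ^ card (IA \<Psi> B) * y ^ card (EA \<Psi> B))"

text \<open>The two indeterminates of \<open>\<int>[x,y]\<close>, realised as \<open>(\<int>[x])[y]\<close>.\<close>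

definition indet_x :: "int poly poly" where
  "indet_x = [:[:0, 1:]:]"

definition indet_y :: "int poly poly" where
  "indet_y = [:0, 1:]"

definition tutte_polynomial :: "'a::linorder cplx \<Rightarrow> int poly poly" where
  "tutte_polynomial \<Psi> = tutte \<Psi> indet_x indet_y"

definition invariant_on :: "'a::linorder cplx set \<Rightarrow> ('a cplx \<Rightarrow> 'r) \<Rightarrow> bool" where
  "invariant_on \<S> f \<longleftrightarrow> (\<forall>\<Psi>\<in>\<S>. \<forall>\<Psi>'\<in>\<S>. isomorphic \<Psi> \<Psi>' \<longrightarrow> f \<Psi> = f \<Psi>')"

text \<open>
  The value of \<open>f\<close> at the empty complex \<open>({}, {{}})\<close> is deliberately not normalised here. For
  instance \<open>\<lambda>_. 0\<close> satisfies both recurrences, whereas the Tutte polynomial of the empty complex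
  is 1; so the formula expressing \<open>f\<close> through the Tutte polynomial can hold at the empty complex
  only if \<open>f ({}, {{}}) = 1\<close>.
\<close>

definition tutte_grothendieck_on ::
    "'a::linorder cplx set \<Rightarrow> ('a cplx \<Rightarrow> 'r::ring_1) \<Rightarrow> bool" where
  "tutte_grothendieck_on \<S> f \<longleftrightarrow>
     invariant_on \<S> f \<and>
     (\<forall>\<Psi>\<in>\<S>. \<forall>e. is_loop \<Psi> e \<or> is_coloop \<Psi> e \<longrightarrow>
        f \<Psi> = f (restriction \<Psi> {e}) * f (restriction \<Psi> (ground \<Psi> - {e}))) \<and>
     (\<forall>\<Psi>\<in>\<S>. \<forall>e. largest_noncoloop_vertex \<Psi> e \<longrightarrow>
        f \<Psi> = f (contraction \<Psi> e) + f (deletion \<Psi> e))"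

end

theory Submission
  imports Defs
begin

text \<open>
  If \<open>e\<close> is the largest non-coloop vertex, then every element of \<open>B2 - B1\<close> is smaller than \<open>e\<close>
  whenever \<open>e \<in> B1\<close> and \<open>e \<notin> B2\<close>, so the exchange axiom of \<open>QE\<close> applies to \<open>e\<close>. It shows that the
  bases of the deletion are exactly the bases avoiding \<open>e\<close>, and that \<open>e\<close> is never internally
  active. A circuit through \<open>e\<close> has \<open>e\<close> as its maximum, so \<open>e\<close> is never externally active and
  contracting it does not change the minimum of a circuit. Hence the activities of all other
  elements are preserved under deletion and contraction. In a pure complex the lexicographic
  condition defining \<open>IA\<close> only compares \<open>b\<close> with the elements that can replace it.
  Universality is induction on the size of the ground set, because the class is closed under
  the minors occurring in the recurrences.
\<close>

section \<open>Bases and circuits\<close>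

lemma osc_finite: "ordered_simplicial_complex \<Psi> \<Longrightarrow> finite (ground \<Psi>)"
  and osc_subset: "ordered_simplicial_complex \<Psi> \<Longrightarrow> I \<in> indep \<Psi> \<Longrightarrow> I \<subseteq> ground \<Psi>"
  and osc_empty: "ordered_simplicial_complex \<Psi> \<Longrightarrow> {} \<in> indep \<Psi>"
  and osc_down: "ordered_simplicial_complex \<Psi> \<Longrightarrow> I \<in> indep \<Psi> \<Longrightarrow> J \<subseteq> I \<Longrightarrow> J \<in> indep \<Psi>"
  unfolding ordered_simplicial_complex_def by blast+

lemma indep_finite:
  "ordered_simplicial_complex \<Psi> \<Longrightarrow> I \<in> indep \<Psi> \<Longrightarrow> finite I"
  by (meson finite_subset osc_finite osc_subset)

lemma finite_bases:
  assumes "ordered_simplicial_complex \<Psi>"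
  shows "finite (bases \<Psi>)"
proof (rule finite_subset)
  show "bases \<Psi> \<subseteq> Pow (ground \<Psi>)"
    using osc_subset[OF assms] by (auto simp: bases_def)
qed (simp add: osc_finite[OF assms])

lemma basesD: "B \<in> bases \<Psi> \<Longrightarrow> B \<in> indep \<Psi>"
  by (simp add: bases_def)

lemma bases_maximal: "B \<in> bases \<Psi> \<Longrightarrow> I \<in> indep \<Psi> \<Longrightarrow> B \<subseteq> I \<Longrightarrow> I = B"
  by (simp add: bases_def)

lemma indep_extends_to_basis:
  assumes "ordered_simplicial_complex \<Psi>" "I \<in> indep \<Psi>"
  obtains B where "B \<in> bases \<Psi>" "I \<subseteq> B"
proof -
  have "finite (indep \<Psi>)"
    using assms(1) unfolding ordered_simplicial_complex_def
    by (meson finite_Pow_iff finite_subset)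
  from finite_has_maximal2[OF this assms(2)] obtain B
    where "B \<in> indep \<Psi>" "I \<subseteq> B" "\<forall>J\<in>indep \<Psi>. B \<subseteq> J \<longrightarrow> B = J" by metis
  then have "B \<in> bases \<Psi>" by (auto simp: bases_def)
  with \<open>I \<subseteq> B\<close> that show ?thesis by blast
qed

lemma dependent_contains_circuit:
  assumes "ordered_simplicial_complex \<Psi>" "A \<subseteq> ground \<Psi>" "A \<notin> indep \<Psi>"
  obtains C where "C \<in> circuits \<Psi>" "C \<subseteq> A"
proof -
  let ?D = "{D. D \<subseteq> A \<and> D \<notin> indep \<Psi>}"
  have "finite A" using assms osc_finite finite_subset by blast
  then have "finite ?D" by simp
  from finite_has_minimal2[OF this, of A] assms(3) obtain C
    where C: "C \<in> ?D" "\<forall>J\<in>?D. J \<subseteq> C \<longrightarrow> C = J" by blast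
  then have "C \<in> circuits \<Psi>" using assms(2) unfolding circuits_def by blast
  with C that show ?thesis by blast
qed

lemma circuitD: "C \<in> circuits \<Psi> \<Longrightarrow> C \<notin> indep \<Psi>"
  "C \<in> circuits \<Psi> \<Longrightarrow> C \<subseteq> ground \<Psi>"
  "C \<in> circuits \<Psi> \<Longrightarrow> D \<subset> C \<Longrightarrow> D \<in> indep \<Psi>"
  by (auto simp: circuits_def)

lemma is_loop_iff:
  assumes "ordered_simplicial_complex \<Psi>"
  shows "is_loop \<Psi> e \<longleftrightarrow> e \<in> ground \<Psi> \<and> {e} \<notin> indep \<Psi>"
  unfolding is_loop_def
  by (metis assms basesD empty_subsetI indep_extends_to_basis insert_subset osc_down)

lemma is_vertex_iff:
  assumes "ordered_simplicial_complex \<Psi>"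
  shows "is_vertex \<Psi> e \<longleftrightarrow> {e} \<in> indep \<Psi>"
  using is_loop_iff[OF assms] osc_subset[OF assms, of "{e}"]
  by (auto simp: is_vertex_def)

text \<open>Every basis extending \<open>I\<close> already contains the coloop.\<close>

lemma coloop_insert_indep:
  assumes "ordered_simplicial_complex \<Psi>" "is_coloop \<Psi> e" "I \<in> indep \<Psi>"
  shows "insert e I \<in> indep \<Psi>"
proof -
  obtain B where "B \<in> bases \<Psi>" "I \<subseteq> B"
    using indep_extends_to_basis[OF assms(1,3)] .
  then show ?thesis
    using assms(1,2) by (metis basesD insert_subset is_coloop_def osc_down)
qed

text \<open>Removing \<open>e\<close> from a circuit would leave a face by minimality, and a coloop
  can be added back to any face.\<close>

lemma coloop_notin_circuit:
  assumes "ordered_simplicial_complex \<Psi>" "is_coloop \<Psi> e" "C \<in> circuits \<Psi>"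
  shows "e \<notin> C"
proof
  assume "e \<in> C"
  then have "insert e (C - {e}) \<in> indep \<Psi>"
    using circuitD(3)[OF assms(3), of "C - {e}"] coloop_insert_indep[OF assms(1,2)] by blast
  then show False
    using \<open>e \<in> C\<close> circuitD(1)[OF assms(3)] by (simp add: insert_absorb)
qed

text \<open>Purity lets cardinality detect bases: a basis extending \<open>I\<close> has the size of
  \<open>I\<close> and so equals it. This turns the outcome of an exchange, known only to be
  independent, into a basis.\<close>

lemma exchange_basis:
  assumes "ordered_simplicial_complex \<Psi>" "pure \<Psi>" "B \<in> bases \<Psi>"
    "I \<in> indep \<Psi>" "card I = card B"
  shows "I \<in> bases \<Psi>"
proof -
  obtain B' where B': "B' \<in> bases \<Psi>" "I \<subseteq> B'"
    using indep_extends_to_basis[OF assms(1,4)] .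
  have "card B' = card I" using assms(2,3,5) B'(1) unfolding pure_def by metis
  then have "I = B'"
    using B' assms(1) by (metis basesD card_subset_eq indep_finite)
  then show ?thesis using B' by simp
qed

section \<open>Deletion and contraction\<close>

lemma ground_contraction [simp]: "ground (contraction \<Psi> e) = ground \<Psi> - {e}"
  by (simp add: contraction_def)

lemma ground_deletion [simp]: "ground (deletion \<Psi> e) = ground \<Psi> - {e}"
  by (simp add: deletion_def restriction_def)

lemma indep_deletion:
  "ordered_simplicial_complex \<Psi> \<Longrightarrow> I \<in> indep (deletion \<Psi> e) \<longleftrightarrow> I \<in> indep \<Psi> \<and> e \<notin> I"
  using osc_subset[of \<Psi> I] by (auto simp: deletion_def restriction_def)

lemma indep_contraction:
  "ordered_simplicial_complex \<Psi> \<Longrightarrow>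
     I \<in> indep (contraction \<Psi> e) \<longleftrightarrow> insert e I \<in> indep \<Psi> \<and> e \<notin> I"
  using osc_subset[of \<Psi> "insert e I"] by (auto simp: contraction_def)

lemma osc_deletion:
  "ordered_simplicial_complex \<Psi> \<Longrightarrow> ordered_simplicial_complex (deletion \<Psi> e)"
  unfolding ordered_simplicial_complex_def deletion_def restriction_def by auto

lemma osc_contraction:
  assumes "ordered_simplicial_complex \<Psi>" "{e} \<in> indep \<Psi>"
  shows "ordered_simplicial_complex (contraction \<Psi> e)"
proof -
  have "J \<in> indep (contraction \<Psi> e)" if "I \<in> indep (contraction \<Psi> e)" "J \<subseteq> I" for I J
    using that osc_down[OF assms(1), of "insert e I" "insert e J"]
    unfolding indep_contraction[OF assms(1)] by blast
  moreover have "indep (contraction \<Psi> e) \<subseteq> Pow (ground (contraction \<Psi> e))"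
    by (auto simp: contraction_def)
  moreover have "finite (ground (contraction \<Psi> e))" using osc_finite[OF assms(1)] by simp
  moreover have "{} \<in> indep (contraction \<Psi> e)"
    using assms(2) by (simp add: indep_contraction[OF assms(1)])
  ultimately show ?thesis
    unfolding ordered_simplicial_complex_def[of "contraction \<Psi> e"] by blast
qed

text \<open>A coloop can be added to every face. Facts about contractions therefore also serve the
  deletion of a coloop.\<close>

lemma contraction_coloop:
  assumes "ordered_simplicial_complex \<Psi>" "is_coloop \<Psi> e"
  shows "contraction \<Psi> e = deletion \<Psi> e"
proof (rule prod_eqI)
  show "indep (contraction \<Psi> e) = indep (deletion \<Psi> e)"
    using coloop_insert_indep[OF assms] osc_down[OF assms(1)]
    by (auto simp: set_eq_iff indep_contraction[OF assms(1)] indep_deletion[OF assms(1)])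
qed simp

lemma circuits_deletion:
  assumes "ordered_simplicial_complex \<Psi>"
  shows "C \<in> circuits (deletion \<Psi> e) \<longleftrightarrow> C \<in> circuits \<Psi> \<and> e \<notin> C"
  by (auto simp: circuits_def indep_deletion[OF assms])

text \<open>The set \<open>insert e D\<close> is dependent, so it contains a circuit
  \<open>C\<close>. If \<open>C - {e}\<close> were smaller than \<open>D\<close>, minimality of
  \<open>D\<close> would make \<open>insert e C\<close> a face, contradicting the dependence of
  \<open>C\<close>.\<close>

lemma circuit_of_contraction:
  assumes "ordered_simplicial_complex \<Psi>" "e \<in> ground \<Psi>" "D \<in> circuits (contraction \<Psi> e)"
  shows "D \<in> circuits \<Psi> \<or> insert e D \<in> circuits \<Psi>"
proof -
  note ic = indep_contraction[OF assms(1)]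
  have D: "D \<subseteq> ground \<Psi>" "e \<notin> D" "insert e D \<notin> indep \<Psi>"
    using circuitD(1,2)[OF assms(3)] by (auto simp: ic)
  obtain C where C: "C \<in> circuits \<Psi>" "C \<subseteq> insert e D"
    using dependent_contains_circuit[OF assms(1), of "insert e D"] D assms(2) by blast
  have "C - {e} = D"
  proof (rule ccontr)
    assume "C - {e} \<noteq> D"
    then have "C - {e} \<subset> D" using C(2) by blast
    then have "C - {e} \<in> indep (contraction \<Psi> e)" by (rule circuitD(3)[OF assms(3)])
    then have "insert e C \<in> indep \<Psi>" by (simp add: ic)
    then show False
      using circuitD(1)[OF C(1)] osc_down[OF assms(1), of "insert e C" C] by blast
  qed
  then show ?thesis
    using C(1) by (metis Diff_empty Diff_insert0 insert_Diff)
qed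

text \<open>In this direction only containment is obtained: \<open>C - {e}\<close> is dependent in
  the contraction, but need not be minimal with that property.\<close>

lemma circuit_contains_contraction_circuit:
  assumes "ordered_simplicial_complex \<Psi>" "{e} \<in> indep \<Psi>" "C \<in> circuits \<Psi>"
  obtains D where "D \<in> circuits (contraction \<Psi> e)" "D \<subseteq> C - {e}"
proof (rule dependent_contains_circuit[OF osc_contraction[OF assms(1,2)]])
  show "C - {e} \<subseteq> ground (contraction \<Psi> e)"
    using circuitD(2)[OF assms(3)] by auto
  show "C - {e} \<notin> indep (contraction \<Psi> e)"
    using circuitD(1)[OF assms(3)] osc_down[OF assms(1), of "insert e C" C]
    by (auto simp: indep_contraction[OF assms(1)])
qed

text \<open>Inserting \<open>e\<close> is an inclusion-preserving correspondence between faces of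
  the contraction and faces containing \<open>e\<close>, and every face above
  \<open>insert e B\<close> contains \<open>e\<close> as well.\<close>

lemma bases_contraction:
  assumes "ordered_simplicial_complex \<Psi>"
  shows "B \<in> bases (contraction \<Psi> e) \<longleftrightarrow> insert e B \<in> bases \<Psi> \<and> e \<notin> B"
proof
  assume B: "B \<in> bases (contraction \<Psi> e)"
  then have *: "insert e B \<in> indep \<Psi>" "e \<notin> B"
    using basesD[OF B] by (auto simp: indep_contraction[OF assms])
  have "I = insert e B" if "I \<in> indep \<Psi>" "insert e B \<subseteq> I" for I
  proof -
    have "I - {e} \<in> indep (contraction \<Psi> e)"
      using that by (auto simp: indep_contraction[OF assms] insert_absorb)
    then have "I - {e} = B"
      using bases_maximal[OF B] that(2) *(2) by blast
    then show ?thesis using that(2) by blast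
  qed
  then show "insert e B \<in> bases \<Psi> \<and> e \<notin> B" using * unfolding bases_def by blast
next
  assume B: "insert e B \<in> bases \<Psi> \<and> e \<notin> B"
  have "I = B" if I: "I \<in> indep (contraction \<Psi> e)" "B \<subseteq> I" for I
  proof -
    have "insert e I = insert e B" "e \<notin> I"
      using I B bases_maximal[of "insert e B" \<Psi> "insert e I"]
      by (auto simp: indep_contraction[OF assms])
    then show ?thesis using B by (simp add: insert_ident)
  qed
  moreover have "B \<in> indep (contraction \<Psi> e)"
    using B by (simp add: indep_contraction[OF assms] basesD)
  ultimately show "B \<in> bases (contraction \<Psi> e)" unfolding bases_def by blast
qed

lemma bases_deletion_loop:
  assumes "ordered_simplicial_complex \<Psi>" "{e} \<notin> indep \<Psi>"
  shows "bases (deletion \<Psi> e) = bases \<Psi>"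
proof -
  have "indep (deletion \<Psi> e) = indep \<Psi>"
    using osc_down[OF assms(1), of _ "{e}"] assms(2)
    by (auto simp: set_eq_iff indep_deletion[OF assms(1)])
  then show "bases (deletion \<Psi> e) = bases \<Psi>"
    by (simp add: bases_def)
qed

section \<open>Exchange at the largest non-coloop vertex\<close>

lemma QE_D:
  assumes "\<Psi> \<in> QE"
  shows "ordered_simplicial_complex \<Psi>" "pure \<Psi>"
    "\<And>B1 B2 b1. B1 \<in> bases \<Psi> \<Longrightarrow> B2 \<in> bases \<Psi> \<Longrightarrow> b1 \<in> B1 - B2 \<Longrightarrow> Max (B2 - B1) < b1 \<Longrightarrow>
       \<exists>b2\<in>B2 - B1. insert b2 (B1 - {b1}) \<in> indep \<Psi>"
  using assms unfolding QE_def by auto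

lemma largest_noncoloop_vertexD:
  assumes "ordered_simplicial_complex \<Psi>" "largest_noncoloop_vertex \<Psi> e"
  shows "{e} \<in> indep \<Psi>" "\<not> is_coloop \<Psi> e" "\<And>v. {v} \<in> indep \<Psi> \<Longrightarrow> \<not> is_coloop \<Psi> v \<Longrightarrow> v \<le> e"
  using assms unfolding largest_noncoloop_vertex_def by (auto simp: is_vertex_iff)

lemma largest_exchange:
  assumes "\<Psi> \<in> QE" "largest_noncoloop_vertex \<Psi> e" "B \<in> bases \<Psi>" "e \<in> B"
  obtains b where "b \<in> ground \<Psi> - B" "b < e" "insert b (B - {e}) \<in> indep \<Psi>"
proof -
  note osc = QE_D(1)[OF assms(1)]
  note e = largest_noncoloop_vertexD[OF osc assms(2)]
  obtain B2 where B2: "B2 \<in> bases \<Psi>" "e \<notin> B2"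
    using e(2) osc_subset[OF osc e(1)] by (auto simp: is_coloop_def)
  \<comment> \<open>Membership in \<open>B2\<close> makes \<open>b\<close> a vertex, absence from
    \<open>B\<close> shows that it is no coloop, and \<open>e \<notin> B2\<close> makes the
    inequality strict.\<close>
  have less: "b < e" if "b \<in> B2 - B" for b
  proof -
    have "{b} \<in> indep \<Psi>"
      using that B2 osc_down[OF osc basesD[OF B2(1)]] by blast
    moreover have "\<not> is_coloop \<Psi> b" using that assms(3) by (auto simp: is_coloop_def)
    ultimately show ?thesis using e(3)[of b] B2(2) that by (cases "b = e") auto
  qed
  \<comment> \<open>\<open>Max\<close> yields a usable bound only on a nonempty set, so
    \<open>B2 \<subseteq> B\<close> has to be excluded first.\<close>
  have ne: "B2 - B \<noteq> {}"
    using bases_maximal[OF B2(1) basesD[OF assms(3)]] B2(2) assms(4) by blast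
  have fin: "finite (B2 - B)" using indep_finite[OF osc basesD[OF B2(1)]] by simp
  have "Max (B2 - B) < e" using fin ne less by simp
  then obtain b where "b \<in> B2 - B" "insert b (B - {e}) \<in> indep \<Psi>"
    using QE_D(3)[OF assms(1,3) B2(1), of e] assms(4) B2(2) by blast
  then show ?thesis
    using that less osc_subset[OF osc basesD[OF B2(1)]] by blast
qed

text \<open>A maximal face \<open>I\<close> of the deletion can fail to be a basis only if
  \<open>I = B - {e}\<close> for a basis \<open>B\<close> through \<open>e\<close>. Exchanging
  \<open>e\<close> for some \<open>b\<close> then gives \<open>insert b I\<close>, a larger face of
  the deletion.\<close>

lemma bases_deletion_largest:
  assumes "\<Psi> \<in> QE" "largest_noncoloop_vertex \<Psi> e"
  shows "bases (deletion \<Psi> e) = {B \<in> bases \<Psi>. e \<notin> B}"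
proof (intro equalityI subsetI)
  note osc = QE_D(1)[OF assms(1)]
  fix I assume I: "I \<in> bases (deletion \<Psi> e)"
  have I': "I \<in> indep \<Psi>" "e \<notin> I"
    using basesD[OF I] by (auto simp: indep_deletion[OF osc])
  obtain B where B: "B \<in> bases \<Psi>" "I \<subseteq> B"
    using indep_extends_to_basis[OF osc I'(1)] .
  have "B - {e} \<in> indep (deletion \<Psi> e)"
    using osc_down[OF osc basesD[OF B(1)]] by (auto simp: indep_deletion[OF osc])
  then have BI: "B - {e} = I" using bases_maximal[OF I] B(2) I'(2) by blast
  have "e \<notin> B"
  proof
    assume "e \<in> B"
    then obtain b where b: "b \<in> ground \<Psi> - B" "b < e" "insert b (B - {e}) \<in> indep \<Psi>"
      using largest_exchange[OF assms B(1)] by blast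
    then have "insert b I \<in> indep (deletion \<Psi> e)"
      using BI I' by (auto simp: indep_deletion[OF osc])
    then show False using bases_maximal[OF I] b(1) B(2) by blast
  qed
  then show "I \<in> {B \<in> bases \<Psi>. e \<notin> B}" using BI B(1) by auto
next
  note osc = QE_D(1)[OF assms(1)]
  fix B assume "B \<in> {B \<in> bases \<Psi>. e \<notin> B}"
  then show "B \<in> bases (deletion \<Psi> e)"
    by (auto simp: bases_def indep_deletion[OF osc])
qed

section \<open>Closure of the class under the recurrences\<close>

text \<open>The inclusion of bases guards purity, since deleting an arbitrary element may create
  smaller bases. It holds for loops and for the largest non-coloop vertex.\<close>

lemma QE_deletion:
  assumes "\<Psi> \<in> QE" "bases (deletion \<Psi> e) \<subseteq> bases \<Psi>"
  shows "deletion \<Psi> e \<in> QE"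
proof -
  note osc = QE_D(1)[OF assms(1)]
  have "pure (deletion \<Psi> e)"
    using QE_D(2)[OF assms(1)] assms(2) by (auto simp: pure_def)
  moreover have "\<exists>b2\<in>B2 - B1. (B1 - {b1}) \<union> {b2} \<in> indep (deletion \<Psi> e)"
    if "B1 \<in> bases (deletion \<Psi> e)" "B2 \<in> bases (deletion \<Psi> e)" "b1 \<in> B1 - B2"
      "Max (B2 - B1) < b1" for B1 B2 b1
  proof -
    have "e \<notin> B1" "e \<notin> B2" using basesD[OF that(1)] basesD[OF that(2)]
      by (auto simp: indep_deletion[OF osc])
    then show ?thesis
      using QE_D(3)[OF assms(1), of B1 B2 b1] that assms(2)
      by (auto simp: indep_deletion[OF osc])
  qed
  ultimately show ?thesis using osc_deletion[OF osc] by (auto simp: QE_def)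
qed

text \<open>Inserting \<open>e\<close> into both bases leaves \<open>B2 - B1\<close> unchanged, so
  the condition on \<open>Max\<close> and the exchanged element carry over.\<close>

lemma QE_contraction:
  assumes "\<Psi> \<in> QE" "{e} \<in> indep \<Psi>"
  shows "contraction \<Psi> e \<in> QE"
proof -
  note osc = QE_D(1)[OF assms(1)]
  note bc = bases_contraction[OF osc]
  have "pure (contraction \<Psi> e)"
    unfolding pure_def
  proof (intro ballI)
    fix B1 B2 assume B: "B1 \<in> bases (contraction \<Psi> e)" "B2 \<in> bases (contraction \<Psi> e)"
    then have "card (insert e B1) = card (insert e B2)"
      using QE_D(2)[OF assms(1)] by (auto simp: pure_def bc)
    moreover have "finite B1" "finite B2"
      using B indep_finite[OF osc_contraction[OF osc assms(2)]] basesD by blast+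
    ultimately show "card B1 = card B2" using B by (simp add: bc)
  qed
  moreover have "\<exists>b2\<in>B2 - B1. (B1 - {b1}) \<union> {b2} \<in> indep (contraction \<Psi> e)"
    if B: "B1 \<in> bases (contraction \<Psi> e)" "B2 \<in> bases (contraction \<Psi> e)" "b1 \<in> B1 - B2"
      "Max (B2 - B1) < b1" for B1 B2 b1
  proof -
    have ne: "e \<notin> B1" "e \<notin> B2" "b1 \<noteq> e" using B by (auto simp: bc)
    have eq: "insert e B2 - insert e B1 = B2 - B1" using ne by blast
    obtain b2 where b2: "b2 \<in> B2 - B1" "insert b2 (insert e B1 - {b1}) \<in> indep \<Psi>"
      using QE_D(3)[OF assms(1), of "insert e B1" "insert e B2" b1] B ne
      unfolding eq by (auto simp: bc)
    have "insert b2 (insert e B1 - {b1}) = insert e ((B1 - {b1}) \<union> {b2})" using ne by blast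
    then show ?thesis using b2 ne by (auto simp: indep_contraction[OF osc])
  qed
  ultimately show ?thesis using osc_contraction[OF osc assms(2)] by (auto simp: QE_def)
qed

lemma QC_deletion:
  assumes "\<Psi> \<in> QC"
  shows "deletion \<Psi> e \<in> QC"
proof -
  have osc: "ordered_simplicial_complex \<Psi>" using assms by (simp add: QC_def)
  show ?thesis
    unfolding QC_def
  proof (intro CollectI conjI ballI impI osc_deletion[OF osc])
    fix C1 C2 c
    assume *: "C1 \<in> circuits (deletion \<Psi> e)" "C2 \<in> circuits (deletion \<Psi> e)" "c \<in> C1 \<inter> C2"
      "C1 \<noteq> C2 \<and> c < Max (C1 - C2 \<union> (C2 - C1))"
    then have "C1 \<in> circuits \<Psi>" "C2 \<in> circuits \<Psi>"
      by (simp_all add: circuits_deletion[OF osc])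
    then obtain C3 where "C3 \<in> circuits \<Psi>" "C3 \<subseteq> C1 \<union> C2 - {c}"
      using assms * unfolding QC_def by blast
    then show "\<exists>C3\<in>circuits (deletion \<Psi> e). C3 \<subseteq> C1 \<union> C2 - {c}"
      using * by (auto simp: circuits_deletion[OF osc] intro!: bexI[of _ C3])
  qed
qed

text \<open>The circuits \<open>D1\<close> and \<open>D2\<close> lift to circuits that agree with
  them away from \<open>e\<close>. Elimination is carried out on the lifts, and the result contains
  a circuit of the contraction after \<open>e\<close> is removed.\<close>

lemma QC_contraction:
  assumes "\<Psi> \<in> QC" "{e} \<in> indep \<Psi>"
  shows "contraction \<Psi> e \<in> QC"
proof -
  have osc: "ordered_simplicial_complex \<Psi>" using assms by (simp add: QC_def)
  have e: "e \<in> ground \<Psi>" using osc_subset[OF osc assms(2)] by simp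
  show ?thesis
    unfolding QC_def
  proof (intro CollectI conjI ballI impI osc_contraction[OF osc assms(2)])
    fix D1 D2 c
    assume *: "D1 \<in> circuits (contraction \<Psi> e)" "D2 \<in> circuits (contraction \<Psi> e)"
      "c \<in> D1 \<inter> D2" "D1 \<noteq> D2 \<and> c < Max (D1 - D2 \<union> (D2 - D1))"
    have eD: "e \<notin> D1" "e \<notin> D2" using circuitD(2)[OF *(1)] circuitD(2)[OF *(2)] by auto
    obtain C1 where C1: "C1 \<in> circuits \<Psi>" "C1 - {e} = D1"
      using circuit_of_contraction[OF osc e *(1)] eD
      by (metis Diff_empty Diff_insert0 Diff_insert_absorb)
    obtain C2 where C2: "C2 \<in> circuits \<Psi>" "C2 - {e} = D2"
      using circuit_of_contraction[OF osc e *(2)] eD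
      by (metis Diff_empty Diff_insert0 Diff_insert_absorb)
    have fin: "finite C1" "finite C2"
      using circuitD(2)[OF C1(1)] circuitD(2)[OF C2(1)] osc_finite[OF osc] finite_subset by auto
    \<comment> \<open>Lifting can only enlarge the symmetric difference, by \<open>e\<close> at
      most, so the bound on \<open>c\<close> survives.\<close>
    have "Max (D1 - D2 \<union> (D2 - D1)) \<le> Max (C1 - C2 \<union> (C2 - C1))"
      using C1(2) C2(2) fin * by (intro Max_mono) auto
    then have "c < Max (C1 - C2 \<union> (C2 - C1))" using * by auto
    moreover have "C1 \<noteq> C2" "c \<in> C1 \<inter> C2" using * C1 C2 by auto
    ultimately obtain C3 where C3: "C3 \<in> circuits \<Psi>" "C3 \<subseteq> C1 \<union> C2 - {c}"
      using assms(1) C1(1) C2(1) unfolding QC_def by blast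
    obtain D3 where "D3 \<in> circuits (contraction \<Psi> e)" "D3 \<subseteq> C3 - {e}"
      using circuit_contains_contraction_circuit[OF osc assms(2) C3(1)] .
    then show "\<exists>D3\<in>circuits (contraction \<Psi> e). D3 \<subseteq> D1 \<union> D2 - {c}"
      using C1 C2 C3 by blast
  qed
qed

section \<open>Activities\<close>

text \<open>Both lists keep the leading entries below \<open>a\<close>. At the first entry
  \<open>x\<close> with \<open>a \<le> x\<close>, nonmembership gives \<open>a < x\<close>, so the
  first list has \<open>a\<close> where the second has \<open>b\<close> or \<open>x\<close>, neither
  of which is smaller.\<close>

lemma insort_lexordp_eq:
  fixes a b :: "'a::linorder"
  shows "a \<le> b \<Longrightarrow> a \<notin> set xs \<Longrightarrow> lexordp_eq (insort a xs) (insort b xs)"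
  by (induction xs) (auto simp: lexordp_eq_refl)

text \<open>One direction is the comparison of sorted lists. The other follows by exchanging
  \<open>a\<close> and \<open>b\<close> and using antisymmetry, since equal sorted lists come from
  equal sets.\<close>

lemma lex_le_insert_iff:
  fixes a b :: "'a::linorder"
  assumes "finite A" "a \<notin> A" "b \<notin> A"
  shows "lex_le (insert a A) (insert b A) \<longleftrightarrow> a \<le> b"
proof -
  have le: "lex_le (insert a A) (insert b A)" if "a \<le> b" "a \<notin> A" "b \<notin> A" for a b
    using that assms(1) by (auto simp: lex_le_def intro: insort_lexordp_eq)
  show ?thesis
  proof
    assume l: "lex_le (insert a A) (insert b A)"
    show "a \<le> b"
    proof (rule ccontr)
      assume "\<not> a \<le> b"
      then have "lex_le (insert b A) (insert a A)" using le assms by simp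
      with l have "sorted_list_of_set (insert a A) = sorted_list_of_set (insert b A)"
        unfolding lex_le_def by (rule lexordp_eq_antisym)
      then have "insert a A = insert b A"
        using assms(1) by (metis finite_insert set_sorted_list_of_set)
      then show False using assms \<open>\<not> a \<le> b\<close> by auto
    qed
  qed (use le assms in simp)
qed

text \<open>By purity, a basis containing \<open>B - {b}\<close> is \<open>B\<close> itself or
  arises by a single replacement of \<open>b\<close>. This form of internal activity involves no
  lists and is the one that passes to minors and isomorphic complexes.\<close>

lemma IA_iff:
  assumes "ordered_simplicial_complex \<Psi>" "pure \<Psi>" "B \<in> bases \<Psi>"
  shows "b \<in> IA \<Psi> B \<longleftrightarrow>
    b \<in> B \<and> (\<forall>b'\<in>ground \<Psi> - B. insert b' (B - {b}) \<in> indep \<Psi> \<longrightarrow> b \<le> b')"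
proof (cases "b \<in> B")
  case b: True
  have fin: "finite B" using indep_finite[OF assms(1) basesD[OF assms(3)]] .
  have lex: "lex_le B (insert b' (B - {b})) \<longleftrightarrow> b \<le> b'" if "b' \<notin> B" for b'
    using lex_le_insert_iff[of "B - {b}" b b'] fin that b by (simp add: insert_absorb)
  show ?thesis
  proof
    assume IA: "b \<in> IA \<Psi> B"
    show "b \<in> B \<and> (\<forall>b'\<in>ground \<Psi> - B. insert b' (B - {b}) \<in> indep \<Psi> \<longrightarrow> b \<le> b')"
    proof (intro conjI ballI impI b)
      fix b' assume b': "b' \<in> ground \<Psi> - B" "insert b' (B - {b}) \<in> indep \<Psi>"
      have "card (insert b' (B - {b})) = card B"
        using card_Suc_Diff1[OF fin b] b' fin by simp
      then have "insert b' (B - {b}) \<in> bases \<Psi>"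
        using exchange_basis[OF assms b'(2)] by simp
      then have "lex_le B (insert b' (B - {b}))" using IA by (auto simp: IA_def)
      then show "b \<le> b'" using lex b' by simp
    qed
  next
    assume R: "b \<in> B \<and> (\<forall>b'\<in>ground \<Psi> - B. insert b' (B - {b}) \<in> indep \<Psi> \<longrightarrow> b \<le> b')"
    have "lex_le B B'" if B': "B' \<in> bases \<Psi>" "B - {b} \<subseteq> B'" for B'
    proof (cases "B' = B")
      case True
      then show ?thesis by (simp add: lex_le_def lexordp_eq_refl)
    next
      case False
      have fin': "finite B'" using indep_finite[OF assms(1) basesD[OF B'(1)]] .
      have "\<not> B' \<subseteq> B"
        using bases_maximal[OF B'(1) basesD[OF assms(3)]] False by blast
      then obtain b' where b': "b' \<in> B'" "b' \<notin> B" by blast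
      \<comment> \<open>The subset \<open>insert b' (B - {b})\<close> of \<open>B'\<close> already
        has the common size of all bases, so it exhausts \<open>B'\<close>.\<close>
      have "card (insert b' (B - {b})) = card B"
        using card_Suc_Diff1[OF fin b] b' fin by simp
      also have "\<dots> = card B'" using assms(2,3) B'(1) unfolding pure_def by blast
      finally have card: "card (insert b' (B - {b})) = card B'" .
      have "insert b' (B - {b}) = B'"
        by (rule card_subset_eq[OF fin' _ card]) (use b' B' in auto)
      moreover have "b' \<in> ground \<Psi>"
        using b' osc_subset[OF assms(1) basesD[OF B'(1)]] by blast
      ultimately show ?thesis using R lex b' basesD[OF B'(1)] by auto
    qed
    then show "b \<in> IA \<Psi> B" using b by (auto simp: IA_def)
  qed
qed (simp add: IA_def)

section \<open>Activities under contraction and deletion\<close>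

lemma EA_subset: "EA \<Psi> B \<subseteq> ground \<Psi> - B"
  by (auto simp: EA_def)

lemma finite_EA: "ordered_simplicial_complex \<Psi> \<Longrightarrow> finite (EA \<Psi> B)"
  by (meson EA_subset finite_Diff finite_subset osc_finite)

lemma finite_IA:
  assumes "ordered_simplicial_complex \<Psi>" "B \<in> bases \<Psi>"
  shows "finite (IA \<Psi> B)"
  using indep_finite[OF assms(1) basesD[OF assms(2)]] by (simp add: IA_def)

text \<open>Any other element of the circuit is a vertex by minimality of \<open>C\<close>, and no
  circuit contains a coloop. The choice of \<open>e\<close> therefore bounds it.\<close>

lemma circuit_le_largest:
  assumes "ordered_simplicial_complex \<Psi>" "largest_noncoloop_vertex \<Psi> e"
    "C \<in> circuits \<Psi>" "e \<in> C" "c \<in> C"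
  shows "c \<le> e"
proof (cases "c = e")
  case False
  then have "{c} \<subset> C" using assms(4,5) by blast
  then have "{c} \<in> indep \<Psi>" using circuitD(3)[OF assms(3)] by blast
  moreover have "\<not> is_coloop \<Psi> c"
    using coloop_notin_circuit[OF assms(1) _ assms(3)] assms(5) by blast
  ultimately show ?thesis using largest_noncoloop_vertexD(3)[OF assms(1,2)] by blast
qed simp

text \<open>Replacing \<open>b\<close> commutes with inserting \<open>e\<close>, so the tests of
  \<open>IA_iff\<close> agree for every \<open>b \<in> B\<close>. The element \<open>e\<close> is
  removed explicitly because it is active when it is a coloop.\<close>

lemma IA_contraction:
  assumes "\<Psi> \<in> QE" "{e} \<in> indep \<Psi>" "B \<in> bases (contraction \<Psi> e)"
  shows "IA (contraction \<Psi> e) B = IA \<Psi> (insert e B) - {e}"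
proof -
  note osc = QE_D(1)[OF assms(1)] and pure = QE_D(2)[OF assms(1)]
  note c = QE_contraction[OF assms(1,2)]
  have B: "insert e B \<in> bases \<Psi>" "e \<notin> B" using assms(3) by (auto simp: bases_contraction[OF osc])
  have G: "ground \<Psi> - insert e B = ground \<Psi> - {e} - B" by blast
  have "b \<in> IA (contraction \<Psi> e) B \<longleftrightarrow> b \<in> IA \<Psi> (insert e B) - {e}" for b
  proof (cases "b \<in> B")
    case True
    then have "insert e (insert b' (B - {b})) = insert b' (insert e B - {b})" for b'
      using B(2) by blast
    then show ?thesis
      using B(2) True
      by (auto simp: IA_iff[OF osc pure B(1)] IA_iff[OF QE_D(1,2)[OF c] assms(3)]
          indep_contraction[OF osc] G simp del: insert_Diff_if)
  next
    case False
    then show ?thesis by (auto simp: IA_def)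
  qed
  then show ?thesis by blast
qed

text \<open>By \<open>max\<close>, adding \<open>e\<close> to a circuit of the contraction cannot
  lower its minimum. For a coloop \<open>e\<close> this hypothesis holds vacuously.\<close>

lemma EA_contraction:
  assumes "ordered_simplicial_complex \<Psi>" "{e} \<in> indep \<Psi>" "B \<in> bases (contraction \<Psi> e)"
    and max: "\<And>C c. C \<in> circuits \<Psi> \<Longrightarrow> e \<in> C \<Longrightarrow> c \<in> C \<Longrightarrow> c \<le> e"
  shows "EA (contraction \<Psi> e) B = EA \<Psi> (insert e B)"
proof (intro equalityI subsetI)
  have e: "e \<in> ground \<Psi>" using osc_subset[OF assms(1,2)] by simp
  fix a assume "a \<in> EA (contraction \<Psi> e) B"
  then obtain D where D: "D \<in> circuits (contraction \<Psi> e)" "D \<subseteq> B \<union> {a}" "a \<in> D" "\<forall>c\<in>D. a \<le> c"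
    and a: "a \<in> ground \<Psi> - insert e B"
    by (auto simp: EA_def)
  consider "D \<in> circuits \<Psi>" | "insert e D \<in> circuits \<Psi>"
    using circuit_of_contraction[OF assms(1) e D(1)] by blast
  then show "a \<in> EA \<Psi> (insert e B)"
  proof cases
    case 1
    then show ?thesis using a D by (auto simp: EA_def)
  next
    case 2
    have "a \<le> e" using max[OF 2] D(3) by blast
    then show ?thesis using a D 2 by (auto simp: EA_def intro!: bexI[of _ "insert e D"])
  qed
next
  fix a assume "a \<in> EA \<Psi> (insert e B)"
  then obtain C where C: "C \<in> circuits \<Psi>" "C \<subseteq> insert e B \<union> {a}" "a \<in> C" "\<forall>c\<in>C. a \<le> c"
    and a: "a \<in> ground \<Psi> - insert e B"
    by (auto simp: EA_def)
  obtain D where D: "D \<in> circuits (contraction \<Psi> e)" "D \<subseteq> C - {e}"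
    using circuit_contains_contraction_circuit[OF assms(1,2) C(1)] .
  \<comment> \<open>Without \<open>a\<close>, the circuit \<open>D\<close> would lie inside the
    basis \<open>B\<close> of the contraction.\<close>
  have "a \<in> D"
  proof (rule ccontr)
    assume "a \<notin> D"
    then have "D \<subseteq> B" using D(2) C(2) by blast
    then show False
      using circuitD(1)[OF D(1)] basesD[OF assms(3)] osc_down[OF osc_contraction[OF assms(1,2)]]
      by blast
  qed
  then show "a \<in> EA (contraction \<Psi> e) B" using a C D by (auto simp: EA_def intro!: bexI[of _ D])
qed

text \<open>Deletion only removes \<open>e\<close> from the possible replacements of
  \<open>b\<close>, and \<open>le\<close> says that this replacement never refutes activity.\<close>

lemma IA_deletion:
  assumes "\<Psi> \<in> QE" "bases (deletion \<Psi> e) \<subseteq> bases \<Psi>" "B \<in> bases (deletion \<Psi> e)"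
    and le: "\<And>b. b \<in> B \<Longrightarrow> insert e (B - {b}) \<in> indep \<Psi> \<Longrightarrow> b \<le> e"
  shows "IA (deletion \<Psi> e) B = IA \<Psi> B"
proof -
  note osc = QE_D(1)[OF assms(1)] and pure = QE_D(2)[OF assms(1)]
  note d = QE_deletion[OF assms(1,2)]
  have B: "B \<in> bases \<Psi>" "e \<notin> B"
    using assms(2,3) basesD[OF assms(3)] by (auto simp: indep_deletion[OF osc])
  show ?thesis
    using B(2) le
    by (auto simp: IA_iff[OF osc pure B(1)] IA_iff[OF QE_D(1,2)[OF d] assms(3)]
        indep_deletion[OF osc] set_eq_iff)
qed

text \<open>For \<open>a \<noteq> e\<close>, a circuit inside \<open>B \<union> {a}\<close> avoids
  \<open>e\<close> and is thus also a circuit of the deletion.\<close>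

lemma EA_deletion:
  assumes "ordered_simplicial_complex \<Psi>" "e \<notin> B"
  shows "EA (deletion \<Psi> e) B = EA \<Psi> B - {e}"
proof -
  have "a \<in> EA (deletion \<Psi> e) B \<longleftrightarrow> a \<in> EA \<Psi> B" if "a \<noteq> e" for a
  proof -
    have "e \<notin> C" if "C \<subseteq> B \<union> {a}" for C using that \<open>a \<noteq> e\<close> assms(2) by blast
    then have "(\<exists>C\<in>circuits (deletion \<Psi> e). C \<subseteq> B \<union> {a} \<and> a \<in> C \<and> (\<forall>c\<in>C. a \<le> c)) \<longleftrightarrow>
        (\<exists>C\<in>circuits \<Psi>. C \<subseteq> B \<union> {a} \<and> a \<in> C \<and> (\<forall>c\<in>C. a \<le> c))"
      unfolding Bex_def circuits_deletion[OF assms(1)] by metis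
    then show ?thesis using that by (simp add: EA_def)
  qed
  then show ?thesis using EA_subset[of "deletion \<Psi> e" B] by auto
qed

section \<open>The recurrences for the Tutte polynomial\<close>

text \<open>The sum is reindexed over the contraction, which equals the deletion here. The coloop
  contributes one internally active element to every basis and meets no circuit.\<close>

lemma tutte_coloop:
  assumes "\<Psi> \<in> QE" "is_coloop \<Psi> e"
  shows "tutte \<Psi> x y = x * tutte (deletion \<Psi> e) x y"
proof -
  note osc = QE_D(1)[OF assms(1)]
  note bc = bases_contraction[OF osc]
  have e: "{e} \<in> indep \<Psi>" using coloop_insert_indep[OF osc assms(2) osc_empty[OF osc]] by simp
  have all: "e \<in> B" if "B \<in> bases \<Psi>" for B
    using that assms(2) by (simp add: is_coloop_def)
  have "tutte \<Psi> x y =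
      (\<Sum>B\<in>bases (contraction \<Psi> e). x ^ card (IA \<Psi> (insert e B)) * y ^ card (EA \<Psi> (insert e B)))"
    unfolding tutte_def
    by (rule sum.reindex_bij_witness[of _ "insert e" "\<lambda>B. B - {e}"])
      (auto simp: bc insert_absorb[OF all])
  also have "\<dots> = (\<Sum>B\<in>bases (contraction \<Psi> e).
      x * (x ^ card (IA (contraction \<Psi> e) B) * y ^ card (EA (contraction \<Psi> e) B)))"
  proof (rule sum.cong[OF refl])
    fix B assume B: "B \<in> bases (contraction \<Psi> e)"
    then have iB: "insert e B \<in> bases \<Psi>" by (simp add: bc)
    \<comment> \<open>No other basis contains \<open>insert e B - {e}\<close>, because each basis
      contains \<open>e\<close>; activity of \<open>e\<close> is then immediate.\<close>
    have "insert e B = B'" if "B' \<in> bases \<Psi>" "insert e B - {e} \<subseteq> B'" for B'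
      using bases_maximal[OF iB basesD[OF that(1)]] that all by blast
    then have "e \<in> IA \<Psi> (insert e B)"
      by (auto simp: IA_def lex_le_def lexordp_eq_refl)
    then have "card (IA \<Psi> (insert e B)) = Suc (card (IA (contraction \<Psi> e) B))"
      using IA_contraction[OF assms(1) e B] finite_IA[OF osc iB] by (metis card.remove)
    moreover have "EA (contraction \<Psi> e) B = EA \<Psi> (insert e B)"
      using coloop_notin_circuit[OF osc assms(2)] by (intro EA_contraction osc e B) blast
    ultimately show "x ^ card (IA \<Psi> (insert e B)) * y ^ card (EA \<Psi> (insert e B)) =
       x * (x ^ card (IA (contraction \<Psi> e) B) * y ^ card (EA (contraction \<Psi> e) B))"
      by (simp add: mult.assoc)
  qed
  finally show ?thesis
    by (simp add: tutte_def sum_distrib_left contraction_coloop[OF osc assms(2)])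
qed

text \<open>The circuit \<open>{e}\<close> makes the loop externally active in every basis.
  Commutation of \<open>x\<close> and \<open>y\<close> serves to move the new factor
  \<open>y\<close> to the left of the power of \<open>x\<close>.\<close>

lemma tutte_loop:
  fixes x y :: "'r::ring_1"
  assumes "\<Psi> \<in> QE" "is_loop \<Psi> e" "x * y = y * x"
  shows "tutte \<Psi> x y = y * tutte (deletion \<Psi> e) x y"
proof -
  note osc = QE_D(1)[OF assms(1)]
  have e: "e \<in> ground \<Psi>" "{e} \<notin> indep \<Psi>" using assms(2) by (auto simp: is_loop_iff[OF osc])
  note bd = bases_deletion_loop[OF osc e(2)]
  have loop: "{e} \<in> circuits \<Psi>" using e osc_empty[OF osc] by (auto simp: circuits_def subset_singleton_iff psubset_eq)
  have "x ^ card (IA \<Psi> B) * y ^ card (EA \<Psi> B) =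
      y * (x ^ card (IA (deletion \<Psi> e) B) * y ^ card (EA (deletion \<Psi> e) B))"
    if B: "B \<in> bases \<Psi>" for B
  proof -
    have eB: "e \<notin> B" using assms(2) B by (simp add: is_loop_def)
    have "IA (deletion \<Psi> e) B = IA \<Psi> B"
    proof (rule IA_deletion[OF assms(1)])
      show "b \<le> e" if "insert e (B - {b}) \<in> indep \<Psi>" for b
        using osc_down[OF osc that, of "{e}"] e by blast
    qed (use B bd in auto)
    moreover have "e \<in> EA \<Psi> B" using loop eB e(1) by (auto simp: EA_def intro!: bexI[of _ "{e}"])
    then have "card (EA \<Psi> B) = Suc (card (EA (deletion \<Psi> e) B))"
      using EA_deletion[OF osc eB] finite_EA[OF osc] by (metis card.remove)
    moreover have "x ^ n * y = y * x ^ n" for n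
      using power_commuting_commutes[OF assms(3)] by simp
    ultimately show ?thesis by (metis mult.assoc power_Suc)
  qed
  then show ?thesis by (simp add: tutte_def sum_distrib_left bd)
qed

text \<open>Bases through \<open>e\<close> correspond to those of the contraction, bases avoiding
  \<open>e\<close> are those of the deletion, and \<open>e\<close> is active in neither
  kind.\<close>

lemma tutte_largest:
  assumes "\<Psi> \<in> QE" "largest_noncoloop_vertex \<Psi> e"
  shows "tutte \<Psi> x y = tutte (contraction \<Psi> e) x y + tutte (deletion \<Psi> e) x y"
proof -
  note osc = QE_D(1)[OF assms(1)] and pure = QE_D(2)[OF assms(1)]
  note bc = bases_contraction[OF osc] and bd = bases_deletion_largest[OF assms]
  note e = largest_noncoloop_vertexD[OF osc assms(2)]
  note circ = circuit_le_largest[OF osc assms(2)]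
  define g where "g \<Phi> B = x ^ card (IA \<Phi> B) * y ^ card (EA \<Phi> B)" for \<Phi> :: "'a cplx" and B
  have "tutte \<Psi> x y = (\<Sum>B\<in>{B \<in> bases \<Psi>. e \<in> B} \<union> {B \<in> bases \<Psi>. e \<notin> B}. g \<Psi> B)"
    unfolding tutte_def g_def by (rule sum.cong) auto
  also have "\<dots> = (\<Sum>B | B \<in> bases \<Psi> \<and> e \<in> B. g \<Psi> B) + (\<Sum>B | B \<in> bases \<Psi> \<and> e \<notin> B. g \<Psi> B)"
    using finite_bases[OF osc] by (intro sum.union_disjoint) auto
  also have "(\<Sum>B | B \<in> bases \<Psi> \<and> e \<in> B. g \<Psi> B) =
      (\<Sum>B\<in>bases (contraction \<Psi> e). g \<Psi> (insert e B))"
    by (rule sum.reindex_bij_witness[of _ "insert e" "\<lambda>B. B - {e}"])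
      (auto simp: bc insert_absorb)
  also have "\<dots> = (\<Sum>B\<in>bases (contraction \<Psi> e). g (contraction \<Psi> e) B)"
  proof (rule sum.cong[OF refl])
    fix B assume B: "B \<in> bases (contraction \<Psi> e)"
    then have iB: "insert e B \<in> bases \<Psi>" by (simp add: bc)
    obtain b where "b \<in> ground \<Psi> - insert e B" "b < e" "insert b (insert e B - {e}) \<in> indep \<Psi>"
      using largest_exchange[OF assms iB] by blast
    then have "e \<notin> IA \<Psi> (insert e B)"
      unfolding IA_iff[OF osc pure iB] by (meson leD)
    then have "IA (contraction \<Psi> e) B = IA \<Psi> (insert e B)"
      using IA_contraction[OF assms(1) e(1) B] by simp
    moreover have "EA (contraction \<Psi> e) B = EA \<Psi> (insert e B)"
      by (intro EA_contraction osc e(1) B circ)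
    ultimately show "g \<Psi> (insert e B) = g (contraction \<Psi> e) B" by (simp add: g_def)
  qed
  also have "(\<Sum>B | B \<in> bases \<Psi> \<and> e \<notin> B. g \<Psi> B) = (\<Sum>B\<in>bases (deletion \<Psi> e). g (deletion \<Psi> e) B)"
  proof (rule sum.cong)
    fix B assume B: "B \<in> bases (deletion \<Psi> e)"
    then have B': "B \<in> bases \<Psi>" "e \<notin> B" by (auto simp: bd)
    have "IA (deletion \<Psi> e) B = IA \<Psi> B"
    proof (rule IA_deletion[OF assms(1) _ B])
      fix b assume b: "b \<in> B" "insert e (B - {b}) \<in> indep \<Psi>"
      \<comment> \<open>A coloop \<open>b\<close> could be added back after the exchange, giving a
        face that contains \<open>B\<close> together with \<open>e\<close>.\<close>
      have "\<not> is_coloop \<Psi> b"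
      proof
        assume "is_coloop \<Psi> b"
        then have "insert b (insert e (B - {b})) \<in> indep \<Psi>"
          using coloop_insert_indep[OF osc] b by blast
        then show False using bases_maximal[OF B'(1)] B'(2) b(1) by blast
      qed
      then show "b \<le> e" using e(3)[of b] osc_down[OF osc basesD[OF B'(1)], of "{b}"] b(1) by blast
    qed (auto simp: bd)
    \<comment> \<open>A witnessing circuit would have \<open>e\<close> as both minimum and maximum,
      hence be \<open>{e}\<close>, but \<open>e\<close> is a vertex.\<close>
    moreover have "e \<notin> EA \<Psi> B"
    proof
      assume "e \<in> EA \<Psi> B"
      then obtain C where C: "C \<in> circuits \<Psi>" "e \<in> C" "\<forall>c\<in>C. e \<le> c" by (auto simp: EA_def)
      then have "C = {e}" using circ[OF C(1,2)] by (auto intro: antisym)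
      then show False using circuitD(1)[OF C(1)] e(1) by simp
    qed
    then have "EA (deletion \<Psi> e) B = EA \<Psi> B" using EA_deletion[OF osc B'(2)] by simp
    ultimately show "g \<Psi> B = g (deletion \<Psi> e) B" by (simp add: g_def)
  qed (simp add: bd)
  finally show ?thesis by (simp add: tutte_def g_def)
qed

section \<open>Isomorphism invariance\<close>

text \<open>The monotone bijection carries faces, bases, circuits and both activities along, so the
  summands match. Purity from \<open>QE\<close> allows \<open>IA_iff\<close> to replace the
  comparison of sorted lists by comparisons of elements.\<close>

lemma tutte_isomorphic:
  assumes "\<Psi> \<in> QE" "\<Psi>' \<in> QE" "isomorphic \<Psi> \<Psi>'"
  shows "tutte \<Psi> x y = tutte \<Psi>' x y"
proof -
  note osc = QE_D(1)[OF assms(1)] and osc' = QE_D(1)[OF assms(2)]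
  obtain \<phi> where bij: "bij_betw \<phi> (ground \<Psi>) (ground \<Psi>')"
    and mono: "strict_mono_on (ground \<Psi>) \<phi>" and img: "(\<lambda>I. \<phi> ` I) ` indep \<Psi> = indep \<Psi>'"
    using assms(3) unfolding isomorphic_def by blast
  have inj: "inj_on \<phi> (ground \<Psi>)" and G: "ground \<Psi>' = \<phi> ` ground \<Psi>"
    using bij by (auto simp: bij_betw_def)
  have le: "\<phi> a \<le> \<phi> b \<longleftrightarrow> a \<le> b" if "a \<in> ground \<Psi>" "b \<in> ground \<Psi>" for a b
    using strict_mono_on_less_eq[OF mono that] .
  have indep: "\<phi> ` I \<in> indep \<Psi>' \<longleftrightarrow> I \<in> indep \<Psi>" if I: "I \<subseteq> ground \<Psi>" for I
  proof
    assume "\<phi> ` I \<in> indep \<Psi>'"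
    then obtain J where J: "J \<in> indep \<Psi>" "\<phi> ` I = \<phi> ` J" unfolding img[symmetric] by auto
    then have "I = J" using inj_on_image_eq_iff[OF inj I osc_subset[OF osc J(1)]] by blast
    then show "I \<in> indep \<Psi>" using J by simp
  qed (use img in blast)
  have subset: "\<phi> ` A \<subseteq> \<phi> ` B \<longleftrightarrow> A \<subseteq> B" if "A \<subseteq> ground \<Psi>" "B \<subseteq> ground \<Psi>" for A B
    using inj_on_image_mem_iff[OF inj _ that(2)] that(1) by blast
  have bases: "\<phi> ` B \<in> bases \<Psi>' \<longleftrightarrow> B \<in> bases \<Psi>" if B: "B \<subseteq> ground \<Psi>" for B
  proof -
    have "(\<forall>I\<in>indep \<Psi>'. \<phi> ` B \<subseteq> I \<longrightarrow> I = \<phi> ` B) \<longleftrightarrow> (\<forall>I\<in>indep \<Psi>. B \<subseteq> I \<longrightarrow> I = B)"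
      unfolding img[symmetric] ball_simps
      by (intro ball_cong refl) (simp add: subset B osc_subset[OF osc] inj_on_image_eq_iff[OF inj])
    then show ?thesis by (simp add: bases_def indep[OF B])
  qed
  have circuits: "\<phi> ` C \<in> circuits \<Psi>' \<longleftrightarrow> C \<in> circuits \<Psi>" if C: "C \<subseteq> ground \<Psi>" for C
  proof -
    have "(\<forall>D. D \<subset> \<phi> ` C \<longrightarrow> D \<in> indep \<Psi>') \<longleftrightarrow> (\<forall>D. D \<subset> C \<longrightarrow> D \<in> indep \<Psi>)"
    proof (intro iffI allI impI)
      fix D assume *: "\<forall>D. D \<subset> \<phi> ` C \<longrightarrow> D \<in> indep \<Psi>'" "D \<subset> C"
      then have D: "D \<subseteq> ground \<Psi>" using C by blast
      have "\<phi> ` D \<subset> \<phi> ` C" using *(2) subset[OF D C] subset[OF C D] by blast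
      then show "D \<in> indep \<Psi>" using * indep[OF D] by blast
    next
      fix D' assume *: "\<forall>D. D \<subset> C \<longrightarrow> D \<in> indep \<Psi>" "D' \<subset> \<phi> ` C"
      then obtain D where D: "D \<subseteq> C" "D' = \<phi> ` D" by (meson psubset_imp_subset subset_imageE)
      then have "D \<subset> C" using *(2) by blast
      then show "D' \<in> indep \<Psi>'" using * indep[of D] C D by blast
    qed
    moreover have "\<phi> ` C \<subseteq> ground \<Psi>'" using C G by blast
    ultimately show ?thesis using C by (simp add: circuits_def indep[OF C])
  qed
  have IA: "IA \<Psi>' (\<phi> ` B) = \<phi> ` IA \<Psi> B" if B: "B \<in> bases \<Psi>" for B
  proof -
    have Bg: "B \<subseteq> ground \<Psi>" using osc_subset[OF osc basesD[OF B]] .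
    have B': "\<phi> ` B \<in> bases \<Psi>'" using bases[OF Bg] B by simp
    have co: "ground \<Psi>' - \<phi> ` B = \<phi> ` (ground \<Psi> - B)"
      using inj_on_image_set_diff[OF inj, of "ground \<Psi>" B] Bg G by auto
    have "\<phi> b \<in> IA \<Psi>' (\<phi> ` B) \<longleftrightarrow> b \<in> IA \<Psi> B" if b: "b \<in> B" for b
    proof -
      have "\<phi> ` B - {\<phi> b} = \<phi> ` (B - {b})"
        using inj_on_image_set_diff[OF inj, of B "{b}"] Bg b by auto
      then have "insert (\<phi> b') (\<phi> ` B - {\<phi> b}) \<in> indep \<Psi>' \<longleftrightarrow> insert b' (B - {b}) \<in> indep \<Psi>"
        if "b' \<in> ground \<Psi>" for b'
        using indep[of "insert b' (B - {b})"] Bg that by auto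
      moreover have "b \<in> ground \<Psi>" using b Bg by blast
      ultimately show ?thesis
        using b le unfolding IA_iff[OF osc' QE_D(2)[OF assms(2)] B'] co
          IA_iff[OF osc QE_D(2)[OF assms(1)] B] by auto
    qed
    then show ?thesis by (auto simp: IA_def)
  qed
  have EA: "EA \<Psi>' (\<phi> ` B) = \<phi> ` EA \<Psi> B" if B: "B \<subseteq> ground \<Psi>" for B
  proof -
    have co: "ground \<Psi>' - \<phi> ` B = \<phi> ` (ground \<Psi> - B)"
      using inj_on_image_set_diff[OF inj, of "ground \<Psi>" B] B G by auto
    have "\<phi> a \<in> EA \<Psi>' (\<phi> ` B) \<longleftrightarrow> a \<in> EA \<Psi> B" if a: "a \<in> ground \<Psi> - B" for a
    proof -
      \<comment> \<open>On the ground set \<open>\<phi>\<close> preserves and reflects the order, so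
        a circuit and its image have corresponding minima.\<close>
      have *: "\<phi> ` C \<subseteq> \<phi> ` B \<union> {\<phi> a} \<and> \<phi> a \<in> \<phi> ` C \<and> (\<forall>c\<in>\<phi> ` C. \<phi> a \<le> c) \<longleftrightarrow>
          C \<subseteq> B \<union> {a} \<and> a \<in> C \<and> (\<forall>c\<in>C. a \<le> c)" if C: "C \<subseteq> ground \<Psi>" for C
      proof -
        have "\<phi> ` C \<subseteq> \<phi> ` B \<union> {\<phi> a} \<longleftrightarrow> C \<subseteq> B \<union> {a}"
          using subset[OF C, of "B \<union> {a}"] a B by simp
        moreover have "\<phi> a \<in> \<phi> ` C \<longleftrightarrow> a \<in> C"
          using inj_on_image_mem_iff[OF inj _ C] a by blast
        moreover have "(\<forall>c\<in>\<phi> ` C. \<phi> a \<le> c) \<longleftrightarrow> (\<forall>c\<in>C. a \<le> c)"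
          using le a C by blast
        ultimately show ?thesis by blast
      qed
      have circ': "circuits \<Psi>' = (`) \<phi> ` circuits \<Psi>"
      proof (intro equalityI subsetI)
        fix C' assume C': "C' \<in> circuits \<Psi>'"
        then obtain C where "C \<subseteq> ground \<Psi>" "C' = \<phi> ` C"
          using circuitD(2)[OF C'] G by (metis subset_imageE)
        then show "C' \<in> (`) \<phi> ` circuits \<Psi>" using circuits C' by blast
      qed (use circuits circuitD(2) in blast)
      have "(\<exists>C\<in>circuits \<Psi>'. C \<subseteq> \<phi> ` B \<union> {\<phi> a} \<and> \<phi> a \<in> C \<and> (\<forall>c\<in>C. \<phi> a \<le> c)) \<longleftrightarrow>
          (\<exists>C\<in>circuits \<Psi>. C \<subseteq> B \<union> {a} \<and> a \<in> C \<and> (\<forall>c\<in>C. a \<le> c))"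
        unfolding circ' bex_simps using * circuitD(2) by (metis (no_types, lifting))
      moreover have "\<phi> a \<in> ground \<Psi>' - \<phi> ` B" using co a by blast
      ultimately show ?thesis using a by (simp add: EA_def)
    qed
    moreover have "EA \<Psi>' (\<phi> ` B) \<subseteq> \<phi> ` (ground \<Psi> - B)" using EA_subset co by metis
    moreover have "EA \<Psi> B \<subseteq> ground \<Psi> - B" by (rule EA_subset)
    ultimately show ?thesis by blast
  qed
  have sub: "B \<subseteq> ground \<Psi>" if "B \<in> bases \<Psi>" for B
    using osc_subset[OF osc basesD[OF that]] .
  have "bases \<Psi>' = (`) \<phi> ` bases \<Psi>"
  proof (intro equalityI subsetI)
    fix B' assume B': "B' \<in> bases \<Psi>'"
    then obtain B where "B \<subseteq> ground \<Psi>" "B' = \<phi> ` B"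
      using osc_subset[OF osc' basesD[OF B']] G by (metis subset_imageE)
    then show "B' \<in> (`) \<phi> ` bases \<Psi>" using bases B' by blast
  qed (use bases sub in blast)
  moreover have "inj_on ((`) \<phi>) (bases \<Psi>)"
    using sub by (auto intro!: inj_onI simp: inj_on_image_eq_iff[OF inj])
  ultimately have "tutte \<Psi>' x y = (\<Sum>B\<in>bases \<Psi>. x ^ card (IA \<Psi>' (\<phi> ` B)) * y ^ card (EA \<Psi>' (\<phi> ` B)))"
    by (simp add: tutte_def sum.reindex)
  also have "\<dots> = tutte \<Psi> x y"
    unfolding tutte_def
  proof (rule sum.cong[OF refl])
    fix B assume B: "B \<in> bases \<Psi>"
    have "IA \<Psi> B \<subseteq> ground \<Psi>" "EA \<Psi> B \<subseteq> ground \<Psi>"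
      using sub[OF B] EA_subset[of \<Psi> B] by (auto simp: IA_def)
    then have "card (\<phi> ` IA \<Psi> B) = card (IA \<Psi> B)" "card (\<phi> ` EA \<Psi> B) = card (EA \<Psi> B)"
      by (metis card_image inj inj_on_subset)+
    then show "x ^ card (IA \<Psi>' (\<phi> ` B)) * y ^ card (EA \<Psi>' (\<phi> ` B)) =
        x ^ card (IA \<Psi> B) * y ^ card (EA \<Psi> B)"
      by (simp add: IA[OF B] EA[OF sub[OF B]])
  qed
  finally show ?thesis by simp
qed

section \<open>Universality\<close>

lemma restriction_loop:
  assumes "ordered_simplicial_complex \<Psi>" "is_loop \<Psi> e"
  shows "restriction \<Psi> {e} = loop_complex e"
  using osc_empty[OF assms(1)] assms
  by (auto simp: restriction_def loop_complex_def is_loop_iff subset_singleton_iff)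

lemma restriction_coloop:
  assumes "ordered_simplicial_complex \<Psi>" "is_coloop \<Psi> e"
  shows "restriction \<Psi> {e} = coloop_complex e"
  using osc_empty[OF assms(1)] coloop_insert_indep[OF assms osc_empty[OF assms(1)]]
  by (auto simp: restriction_def coloop_complex_def subset_singleton_iff)

lemma loop_complex_bases: "bases (loop_complex e) = {{}}"
  and loop_complex_circuits: "circuits (loop_complex e) = {{e}}"
  by (auto simp: bases_def circuits_def loop_complex_def subset_singleton_iff psubset_eq)

lemma coloop_complex_bases: "bases (coloop_complex e) = {{e}}"
  and coloop_complex_circuits: "circuits (coloop_complex e) = {}"
  by (auto simp: bases_def circuits_def coloop_complex_def subset_singleton_iff)

lemma loop_complex_mem: "loop_complex e \<in> QE \<inter> QC"
proof -
  have "ordered_simplicial_complex (loop_complex e)"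
    by (auto simp: ordered_simplicial_complex_def loop_complex_def)
  then show ?thesis
    by (simp add: QE_def QC_def pure_def loop_complex_bases loop_complex_circuits)
qed

lemma coloop_complex_mem: "coloop_complex e \<in> QE \<inter> QC"
proof -
  have "ordered_simplicial_complex (coloop_complex e)"
    by (auto simp: ordered_simplicial_complex_def coloop_complex_def)
  then show ?thesis
    by (simp add: QE_def QC_def pure_def coloop_complex_bases coloop_complex_circuits)
qed

lemma tutte_loop_complex: "tutte (loop_complex e) x y = y"
proof -
  have "EA (loop_complex e) {} = {e}"
    by (auto simp: EA_def loop_complex_circuits) (auto simp: loop_complex_def)
  moreover have "IA (loop_complex e) {} = {}" by (simp add: IA_def)
  ultimately show ?thesis by (simp add: tutte_def loop_complex_bases)
qed

lemma tutte_coloop_complex: "tutte (coloop_complex e) x y = x"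
proof -
  have "EA (coloop_complex e) {e} = {}"
    by (simp add: EA_def coloop_complex_circuits)
  moreover have "IA (coloop_complex e) {e} = {e}"
    by (auto simp: IA_def coloop_complex_bases lex_le_def lexordp_eq_refl)
  ultimately show ?thesis by (simp add: tutte_def coloop_complex_bases)
qed

lemma tutte_empty: "tutte (({}, {{}}) :: 'a::linorder cplx) x y = 1"
proof -
  have "bases (({}, {{}}) :: 'a cplx) = {{}}" by (auto simp: bases_def)
  then show ?thesis by (simp add: tutte_def IA_def EA_def)
qed

text \<open>This makes the values of an invariant at a loop and at a coloop independent of the
  chosen element.\<close>

lemma singleton_isomorphic:
  fixes a b :: "'a::linorder"
  shows "isomorphic (loop_complex a) (loop_complex b)"
    and "isomorphic (coloop_complex a) (coloop_complex b)"
  unfolding isomorphic_def loop_complex_def coloop_complex_def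
  by (auto intro!: exI[of _ "\<lambda>_. b"] simp: bij_betw_def strict_mono_on_def)

text \<open>Stated for commuting elements of any ring; the Tutte polynomial is the case of two
  indeterminates.\<close>

lemma tutte_grothendieck_tutte:
  fixes x y :: "'r::ring_1"
  assumes "x * y = y * x"
  shows "tutte_grothendieck_on (QE \<inter> QC) (\<lambda>\<Psi> :: 'a::linorder cplx. tutte \<Psi> x y)"
  unfolding tutte_grothendieck_on_def
proof (intro conjI ballI allI impI)
  show "invariant_on (QE \<inter> QC) (\<lambda>\<Psi> :: 'a cplx. tutte \<Psi> x y)"
    unfolding invariant_on_def using tutte_isomorphic by blast
next
  fix \<Psi> :: "'a cplx" and e
  assume \<Psi>: "\<Psi> \<in> QE \<inter> QC" and "is_loop \<Psi> e \<or> is_coloop \<Psi> e"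
  then consider "is_loop \<Psi> e" | "is_coloop \<Psi> e" by blast
  then show "tutte \<Psi> x y =
      tutte (restriction \<Psi> {e}) x y * tutte (restriction \<Psi> (ground \<Psi> - {e})) x y"
    unfolding deletion_def[symmetric]
  proof cases
    case 1
    then show "tutte \<Psi> x y = tutte (restriction \<Psi> {e}) x y * tutte (deletion \<Psi> e) x y"
      using tutte_loop[OF _ _ assms, of \<Psi> e] restriction_loop[of \<Psi> e] \<Psi>
      by (simp add: QE_D(1) tutte_loop_complex)
  next
    case 2
    then show "tutte \<Psi> x y = tutte (restriction \<Psi> {e}) x y * tutte (deletion \<Psi> e) x y"
      using tutte_coloop[of \<Psi> e] restriction_coloop[of \<Psi> e] \<Psi>
      by (simp add: QE_D(1) tutte_coloop_complex)
  qed
qed (use tutte_largest in blast)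

section \<open>Arbitrary Tutte-Grothendieck invariants\<close>

lemma tutte_grothendieck_onD:
  assumes "tutte_grothendieck_on \<S> f" "\<Psi> \<in> \<S>"
  shows "\<Psi>' \<in> \<S> \<Longrightarrow> isomorphic \<Psi> \<Psi>' \<Longrightarrow> f \<Psi> = f \<Psi>'"
    and "is_loop \<Psi> e \<or> is_coloop \<Psi> e \<Longrightarrow> f \<Psi> = f (restriction \<Psi> {e}) * f (deletion \<Psi> e)"
    and "largest_noncoloop_vertex \<Psi> e \<Longrightarrow> f \<Psi> = f (contraction \<Psi> e) + f (deletion \<Psi> e)"
  using assms unfolding tutte_grothendieck_on_def invariant_on_def deletion_def by blast+

text \<open>The target ring need not be commutative, but splitting the complex consisting of one loop and
  one coloop in both possible orders shows that the two values of \<open>f\<close> commute.\<close>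

lemma tutte_grothendieck_commute:
  fixes f :: "'a::linorder cplx \<Rightarrow> 'r::ring_1"
  assumes "tutte_grothendieck_on (QE \<inter> QC) f" "a \<noteq> b"
  shows "f (coloop_complex b) * f (loop_complex a) = f (loop_complex a) * f (coloop_complex b)"
proof -
  define \<Phi> :: "'a cplx" where "\<Phi> = ({a, b}, {{}, {b}})"
  have osc: "ordered_simplicial_complex \<Phi>"
    by (auto simp: ordered_simplicial_complex_def \<Phi>_def)
  have bases: "bases \<Phi> = {{b}}" by (auto simp: bases_def \<Phi>_def)
  have ground: "ground \<Phi> = {a, b}" by (simp add: \<Phi>_def)
  have a: "is_loop \<Phi> a" using assms(2) by (simp add: is_loop_def bases ground)
  have b: "is_coloop \<Phi> b" by (simp add: is_coloop_def bases ground)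
  \<comment> \<open>With one basis and at most one circuit, the exchange and elimination axioms hold
    vacuously.\<close>
  have "C = {a}" if C: "C \<in> circuits \<Phi>" for C
  proof -
    have "C \<subseteq> {a}" using circuitD(2)[OF C] coloop_notin_circuit[OF osc b C] ground by auto
    moreover have "C \<noteq> {}" using circuitD(1)[OF C] osc_empty[OF osc] by blast
    ultimately show ?thesis by blast
  qed
  then have \<Phi>: "\<Phi> \<in> QE \<inter> QC"
    using osc by (auto simp: QE_def QC_def pure_def bases)
  have "deletion \<Phi> a = coloop_complex b" "deletion \<Phi> b = loop_complex a"
    using assms(2) by (auto simp: deletion_def restriction_def \<Phi>_def loop_complex_def coloop_complex_def)
  then show ?thesis
    using tutte_grothendieck_onD(2)[OF assms(1) \<Phi>, of a] tutte_grothendieck_onD(2)[OF assms(1) \<Phi>, of b]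
      a b restriction_loop[OF osc a] restriction_coloop[OF osc b] by simp
qed

text \<open>For a loop or the largest non-coloop vertex, bases of the deletion are bases of
  \<open>\<Psi>\<close>. For a coloop they are not, and the deletion is treated as a contraction
  instead.\<close>

lemma deletion_mem:
  assumes "\<Psi> \<in> QE \<inter> QC" "is_loop \<Psi> e \<or> is_coloop \<Psi> e \<or> largest_noncoloop_vertex \<Psi> e"
  shows "deletion \<Psi> e \<in> QE \<inter> QC"
proof -
  have QE: "\<Psi> \<in> QE" and QC: "\<Psi> \<in> QC" using assms(1) by auto
  note osc = QE_D(1)[OF QE]
  consider "is_loop \<Psi> e" | "is_coloop \<Psi> e" | "largest_noncoloop_vertex \<Psi> e"
    using assms(2) by blast
  then have "deletion \<Psi> e \<in> QE"
  proof cases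
    case 1
    then show ?thesis
      using QE_deletion[OF QE] bases_deletion_loop[OF osc] is_loop_iff[OF osc] by simp
  next
    case 2
    then show ?thesis
      using QE_contraction[OF QE, of e] contraction_coloop[OF osc 2]
        coloop_insert_indep[OF osc 2 osc_empty[OF osc]] by simp
  next
    case 3
    then show ?thesis using QE_deletion[OF QE] bases_deletion_largest[OF QE 3] by simp
  qed
  then show ?thesis using QC_deletion[OF QC] by blast
qed

lemma contraction_mem:
  assumes "\<Psi> \<in> QE \<inter> QC" "{e} \<in> indep \<Psi>"
  shows "contraction \<Psi> e \<in> QE \<inter> QC"
  using assms QE_contraction QC_contraction by blast

lemma exists_largest_noncoloop_vertex:
  assumes "ordered_simplicial_complex \<Psi>" "v \<in> ground \<Psi>" "\<not> is_loop \<Psi> v" "\<not> is_coloop \<Psi> v"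
  obtains e where "largest_noncoloop_vertex \<Psi> e"
proof -
  let ?V = "{v. is_vertex \<Psi> v \<and> \<not> is_coloop \<Psi> v}"
  have "finite ?V"
    by (rule finite_subset[OF _ osc_finite[OF assms(1)]]) (auto simp: is_vertex_def)
  moreover have "v \<in> ?V" using assms by (simp add: is_vertex_def)
  ultimately have "Max ?V \<in> ?V" "\<forall>w\<in>?V. w \<le> Max ?V"
    using Max_in[of ?V] by auto
  then have "largest_noncoloop_vertex \<Psi> (Max ?V)"
    by (simp add: largest_noncoloop_vertex_def)
  then show ?thesis using that by blast
qed

text \<open>Each recurrence reduces to smaller members of the class. One-element ground sets are
  settled directly, so the induction from a nonempty ground set never reaches the empty complex,
  where \<open>f\<close> need not be 1.\<close>

lemma tutte_grothendieck_universal: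
  fixes f :: "'a::linorder cplx \<Rightarrow> 'r::ring_1"
  assumes f: "tutte_grothendieck_on (QE \<inter> QC) f"
    and "\<Psi> \<in> QE \<inter> QC" "ground \<Psi> \<noteq> {} \<or> f ({}, {{}}) = 1"
  shows "f \<Psi> = tutte \<Psi> (f (coloop_complex e)) (f (loop_complex e))"
  using assms(2,3)
proof (induction "card (ground \<Psi>)" arbitrary: \<Psi> rule: less_induct)
  case less
  let ?x = "f (coloop_complex e)" and ?y = "f (loop_complex e)"
  have QE: "\<Psi> \<in> QE" using less.prems by simp
  note osc = QE_D(1)[OF QE]
  note rec = tutte_grothendieck_onD[OF f less.prems(1)]
  have x: "f (coloop_complex v) = ?x" and y: "f (loop_complex v) = ?y" for v
    using tutte_grothendieck_onD(1)[OF f coloop_complex_mem coloop_complex_mem]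
      tutte_grothendieck_onD(1)[OF f loop_complex_mem loop_complex_mem]
      singleton_isomorphic by blast+
  have smaller: "card (ground \<Psi> - {v}) < card (ground \<Psi>)" if "v \<in> ground \<Psi>" for v
    using osc_finite[OF osc] that by (rule card_Diff1_less)
  have IH: "f \<Phi> = tutte \<Phi> ?x ?y"
    if "\<Phi> \<in> QE \<inter> QC" "ground \<Phi> = ground \<Psi> - {v}" "v \<in> ground \<Psi>" "ground \<Psi> - {v} \<noteq> {}" for \<Phi> v
    using less.hyps[of \<Phi>] that smaller by metis
  consider "ground \<Psi> = {}" | (loop) v where "is_loop \<Psi> v" | (coloop) v where "is_coloop \<Psi> v"
    | (other) v where "v \<in> ground \<Psi>" "\<not> is_loop \<Psi> v" "\<not> is_coloop \<Psi> v"
    by blast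
  then show ?case
  proof cases
    case 1
    then have "indep \<Psi> = {{}}" using osc by (auto simp: ordered_simplicial_complex_def)
    with 1 have "\<Psi> = ({}, {{}})" by (simp add: prod_eq_iff)
    then show ?thesis using less.prems(2) by (simp add: tutte_empty)
  next
    case loop
    then have v: "v \<in> ground \<Psi>" by (simp add: is_loop_def)
    show ?thesis
    proof (cases "ground \<Psi> = {v}")
      case True
      then have "\<Psi> = restriction \<Psi> {v}"
        using osc by (auto simp: restriction_def prod_eq_iff ordered_simplicial_complex_def)
      then have "\<Psi> = loop_complex v" using restriction_loop[OF osc loop] by simp
      then show ?thesis by (simp add: tutte_loop_complex y[of v])
    next
      case False
      \<comment> \<open>A second element of the ground set is what allows the complex with loop
        \<open>v\<close> and coloop \<open>w\<close> to be formed, from which commutation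
        follows.\<close>
      then obtain w where "w \<in> ground \<Psi>" "w \<noteq> v" using v by blast
      then have commute: "?x * ?y = ?y * ?x"
        using tutte_grothendieck_commute[OF f, of v w] by (simp add: x[of w] y[of v])
      have "f \<Psi> = ?y * f (deletion \<Psi> v)"
        using rec(2)[of v] loop restriction_loop[OF osc loop] by (simp add: y[of v])
      also have "f (deletion \<Psi> v) = tutte (deletion \<Psi> v) ?x ?y"
        using deletion_mem[OF less.prems(1)] loop v False by (intro IH[of _ v]) auto
      finally show ?thesis by (simp only: tutte_loop[OF QE loop commute])
    qed
  next
    case coloop
    then have v: "v \<in> ground \<Psi>" by (simp add: is_coloop_def)
    show ?thesis
    proof (cases "ground \<Psi> = {v}")
      case True
      then have "\<Psi> = restriction \<Psi> {v}"
        using osc by (auto simp: restriction_def prod_eq_iff ordered_simplicial_complex_def)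
      then have "\<Psi> = coloop_complex v" using restriction_coloop[OF osc coloop] by simp
      then show ?thesis by (simp add: tutte_coloop_complex x[of v])
    next
      case False
      have "f \<Psi> = ?x * f (deletion \<Psi> v)"
        using rec(2)[of v] coloop restriction_coloop[OF osc coloop] by (simp add: x[of v])
      also have "f (deletion \<Psi> v) = tutte (deletion \<Psi> v) ?x ?y"
        using deletion_mem[OF less.prems(1)] coloop v False by (intro IH[of _ v]) auto
      finally show ?thesis by (simp only: tutte_coloop[OF QE coloop])
    qed
  next
    case other
    obtain w where w: "largest_noncoloop_vertex \<Psi> w"
      using exists_largest_noncoloop_vertex[OF osc other] .
    note wD = largest_noncoloop_vertexD[OF osc w]
    have wg: "w \<in> ground \<Psi>" using osc_subset[OF osc wD(1)] by simp
    obtain B where "B \<in> bases \<Psi>" "{w} \<subseteq> B" using indep_extends_to_basis[OF osc wD(1)] .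
    \<comment> \<open>Exchanging \<open>w\<close> out of \<open>B\<close> produces an element of the
      ground set other than \<open>w\<close>, so both minors have nonempty ground sets.\<close>
    then have ne: "ground \<Psi> - {w} \<noteq> {}"
      using largest_exchange[OF QE w, of B] by blast
    have "f (contraction \<Psi> w) = tutte (contraction \<Psi> w) ?x ?y"
      using contraction_mem[OF less.prems(1) wD(1)] wg ne by (intro IH[of _ w]) auto
    moreover have "f (deletion \<Psi> w) = tutte (deletion \<Psi> w) ?x ?y"
      using deletion_mem[OF less.prems(1)] w wg ne by (intro IH[of _ w]) auto
    ultimately show ?thesis by (simp only: rec(3)[OF w] tutte_largest[OF QE w])
  qed
qed

theorem theorem6p2:
  shows "tutte_grothendieck_on (QE \<inter> QC) (tutte_polynomial :: 'a::linorder cplx \<Rightarrow> int poly poly) \<and>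
    (\<forall>f :: 'a cplx \<Rightarrow> 'r::ring_1. tutte_grothendieck_on (QE \<inter> QC) f \<longrightarrow>
       (\<forall>\<Psi> \<in> QE \<inter> QC. \<forall>e :: 'a. ground \<Psi> \<noteq> {} \<or> f ({}, {{}}) = 1 \<longrightarrow>
          f \<Psi> = tutte \<Psi> (f (coloop_complex e)) (f (loop_complex e))))"
proof (intro conjI allI impI ballI)
  show "tutte_grothendieck_on (QE \<inter> QC) (tutte_polynomial :: 'a cplx \<Rightarrow> int poly poly)"
    unfolding tutte_polynomial_def[abs_def]
    by (rule tutte_grothendieck_tutte) (rule mult.commute)
qed (rule tutte_grothendieck_universal)

end
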